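(* Let $n,k$ be integers with $k>n-k>0$ and let $\mu\in\mathcal{OP}_n$ (a partition of $n$ into odd parts). Then $$\zeta^{(k,n-k)}_{\mu}(q)=\frac{1}{2(q-1)^{l(\mu)}}\left(\sum_{i=k+1}^{n}(-1)^{i-k}c_i(\mu;q)+\sum_{i=k}^{n}(-1)^{i-k}c_i(\mu;q)\right).$$
   Context: Partitions: $l(\lambda)$ is the number of nonzero parts; $\mathcal{SP}_n$ (resp. $\mathcal{OP}_n$) is the set of strict partitions (resp. partitions with all parts odd) of $n$; $\delta(\lambda)\in\{0,1\}$ is the parity of $l(\lambda)$; $\epsilon(\lambda)=\frac{l(\lambda)-\delta(\lambda)}{2}=\lfloor l(\lambda)/2\rfloor$; $z_\lambda=\prod_{i\ge1}i^{m_i}m_i!$ with $m_i$ the multiplicity of $i$ in $\lambda$. Ring and form: $\Gamma=\mathbb{Q}(q)[p_1,p_3,p_5,\dots]$ is generated by the odd power sums, with the bilinear form $\langle p_\lambda,p_\mu\rangle=2^{-l(\lambda)}z_\lambda\delta_{\lambda\mu}$ for odd partitions $\lambda,\mu$. Operators $Q_n$ ($n\in\mathbb Z$) on $\Gamma$ are defined by $\sum_{n}Q_nz^n=\exp\big(\sum_{n\ge1,\,\mathrm{odd}}\frac2n p_nz^n\big)\exp\big(-\sum_{n\ge1,\,\mathrm{odd}}\frac{\partial}{\partial p_n}z^{-n}\big)$, and for strict $\lambda=(\lambda_1,\dots,\lambda_l)$, $Q_\lambda=Q_{\lambda_1}\cdots Q_{\lambda_l}.1$ is Schur's $Q$-function;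 $\langle Q_\lambda,Q_\mu\rangle=2^{l(\lambda)}\delta_{\lambda\mu}$. Characters: define $g_n\in\Gamma$ by $\sum_{n\ge0}g_nz^n=\exp\big(\sum_{n\ge1,\,\mathrm{odd}}\frac{2(q^n-1)}{n}p_nz^n\big)$, and $g_\mu=g_{\mu_1}g_{\mu_2}\cdots$. The number $\zeta^\lambda_\mu(q)$ ($\lambda$ strict, $\mu$ a partition, both of $n$) is the value of the irreducible character of the Hecke-Clifford algebra $\mathcal H^c_n$ labelled by $\lambda$ at the standard element $T_{\gamma_\mu}$; it is determined by the Frobenius formula $\frac{g_\mu}{(q-1)^{l(\mu)}}=\sum_{\lambda\in\mathcal{SP}_n}2^{-\frac{l(\lambda)+\delta(\lambda)}2}\zeta^\lambda_\mu(q)Q_\lambda$, equivalently $\zeta^\lambda_\mu(q)=2^{-\epsilon(\lambda)}(q-1)^{-l(\mu)}\langle g_\mu,Q_\lambda\rangle$, which may be taken as its definition. Polynomials: $(k)_t=\frac{t^k-(-1)^k}{t+1}$ for $k>0$, $(0)_t=1$, $(k)_t=0$ for $k<0$. A composition $\tau$ is a finite sequence of nonnegative integers, $l(\tau)$ is its number of nonzero parts, and $(\tau)_t=\prod_a(\tau_a)_t$; $f_\tau=2^{l(\tau)}(t-1)^{l(\tau)}(\tau)_t$. For $\mu=(\mu_1,\dots,\mu_r)$, $\mathcal C^\mu_i$ is the set of compositions $\tau=(\tau_1,\dots,\tau_r)$ with $\sum_a\tau_a=i$ and $\tau_a\le\mu_a$ for all $a$; $\mu-\tau=(\mu_1-\tau_1,\dots,\mu_r-\tau_r)$.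 For $1\le i\le n$, $$c_i(\mu;t)=\sum_{\tau\in\mathcal C^\mu_i}f_\tau f_{\mu-\tau}=\sum_{\tau\in\mathcal C^\mu_i}(2t-2)^{l(\tau)+l(\mu-\tau)}(\tau)_t(\mu-\tau)_t .$$ *)

theory Defs
  imports
    Complex_Main
    "HOL-Library.Poly_Mapping"
    "HOL-Library.Multiset"
    "HOL-Library.Groups_Big_Fun"
    "HOL-Computational_Algebra.Polynomial"
    "HOL-Computational_Algebra.Fraction_Field"
    "HOL-Computational_Algebra.Formal_Power_Series"
begin

section \<open>Partitions and compositions\<close>

text \<open>Partitions and compositions are lists of naturals; partitions carry no zero entries.\<close>

definition partitions :: "nat \<Rightarrow> nat list set" where
  "partitions n = {\<mu>. sorted_wrt (\<ge>) \<mu> \<and> (\<forall>i\<in>set \<mu>. 0 < i) \<and> sum_list \<mu> = n}"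

definition odd_partitions :: "nat \<Rightarrow> nat list set" where
  "odd_partitions n = {\<mu> \<in> partitions n. \<forall>i\<in>set \<mu>. odd i}"

definition num_parts :: "nat list \<Rightarrow> nat" where
  "num_parts \<mu> = length (filter (\<lambda>i. i \<noteq> 0) \<mu>)"

definition z_part :: "nat list \<Rightarrow> nat" where
  "z_part \<mu> = (\<Prod>i\<in>set \<mu>. i ^ count_list \<mu> i * fact (count_list \<mu> i))"


section \<open>The ring of odd power sums\<close>

type_synonym Qq = "rat poly fract"

definition qvar :: Qq where
  "qvar = Fract [:0, 1:] 1"

text \<open>Polynomials over \<open>\<rat>(q)\<close> in variables indexed by \<open>nat\<close>: an element maps each exponent
  vector to its coefficient.  The variable with index \<open>j\<close> is \<open>p\<^sub>2\<^sub>j\<^sub>+\<^sub>1\<close>, so that the whole type is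
  the ring \<open>\<Gamma>\<close>.\<close>

type_synonym gamma = "(nat \<Rightarrow>\<^sub>0 nat) \<Rightarrow>\<^sub>0 Qq"

definition const :: "Qq \<Rightarrow> gamma" where
  "const c = Poly_Mapping.single 0 c"

text \<open>Only meaningful for odd \<open>n\<close>; the variable \<open>p\<^sub>n\<close> has index \<open>(n - 1) / 2 = n div 2\<close>.\<close>

definition psum :: "nat \<Rightarrow> gamma" where
  "psum n = Poly_Mapping.single (Poly_Mapping.single (n div 2) 1) 1"

definition psum_part :: "nat list \<Rightarrow> gamma" where
  "psum_part \<nu> = prod_list (map psum \<nu>)"

text \<open>The derivation \<open>\<partial>/\<partial>p\<^sub>n\<close>, again for odd \<open>n\<close>.\<close>

definition dpsum :: "nat \<Rightarrow> gamma \<Rightarrow> gamma" where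
  "dpsum n f = (\<Sum>e\<in>Poly_Mapping.keys f. Poly_Mapping.single (e - Poly_Mapping.single (n div 2) 1)
                   (of_nat (Poly_Mapping.lookup e (n div 2)) * Poly_Mapping.lookup f e))"

text \<open>The bilinear form for which the monomials are orthogonal.  For the monomial \<open>p\<^sub>\<nu>\<close> with exponent
  vector \<open>e\<close>, the multiplicity of \<open>2 j + 1\<close> in \<open>\<nu>\<close> is \<open>lookup e j\<close>, so \<open>mono_norm e\<close> is
  \<open>z\<^sub>\<nu> / 2 ^ l(\<nu>)\<close>; see \<open>gform_psum_part\<close> below.\<close>

definition mono_norm :: "(nat \<Rightarrow>\<^sub>0 nat) \<Rightarrow> Qq" where
  "mono_norm e = of_nat (\<Prod>j\<in>Poly_Mapping.keys e. (2 * j + 1) ^ Poly_Mapping.lookup e j * fact (Poly_Mapping.lookup e j))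
                   / 2 ^ (\<Sum>j\<in>Poly_Mapping.keys e. Poly_Mapping.lookup e j)"

definition gform :: "gamma \<Rightarrow> gamma \<Rightarrow> Qq" where
  "gform f g = (\<Sum>e\<in>Poly_Mapping.keys f \<inter> Poly_Mapping.keys g. Poly_Mapping.lookup f e * Poly_Mapping.lookup g e * mono_norm e)"


section \<open>Schur's Q-functions and the functions \<open>g\<close>\<close>

text \<open>The exponential \<open>\<Sum>\<^sub>j F\<^sup>j / j!\<close> of a series without constant term: as \<open>F\<^sup>j\<close> is divisible by
  \<open>z\<^sup>j\<close>, only \<open>j \<le> m\<close> contributes to the coefficient of \<open>z\<^sup>m\<close>.\<close>

definition gexp :: "gamma fps \<Rightarrow> gamma fps" where
  "gexp F = Abs_fps (\<lambda>m. \<Sum>j\<le>m. const (1 / of_nat (fact j)) * fps_nth (F ^ j) m)"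

definition creation :: "gamma fps" where
  "creation = gexp (Abs_fps (\<lambda>n. if odd n then const (2 / of_nat n) * psum n else 0))"

text \<open>The operator \<open>-(\<Sum>n odd. \<partial>/\<partial>p\<^sub>n w\<^sup>n)\<close> with \<open>w = z\<^sup>-\<^sup>1\<close>, acting on power series in \<open>w\<close>
  with coefficients in \<open>\<Gamma>\<close>.\<close>

definition annihilation_log :: "gamma fps \<Rightarrow> gamma fps" where
  "annihilation_log F =
     Abs_fps (\<lambda>m. - (\<Sum>n | odd n \<and> n \<le> m. dpsum n (fps_nth F (m - n))))"

text \<open>Its exponential applied to \<open>f \<in> \<Gamma>\<close>, truncated as in \<open>gexp\<close>.\<close>

definition annihilation :: "gamma \<Rightarrow> gamma fps" where
  "annihilation f = Abs_fps (\<lambda>m. \<Sum>j\<le>m. const (1 / of_nat (fact j)) *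
                                  fps_nth ((annihilation_log ^^ j) (fps_const f)) m)"

text \<open>The coefficient of \<open>z\<^sup>n\<close> in the product of the two exponentials.  The sum has only finitely many
  nonzero terms (\<open>finite_vertexQ_support\<close> below).\<close>

definition vertexQ :: "int \<Rightarrow> gamma \<Rightarrow> gamma" where
  "vertexQ n f = Sum_any (\<lambda>m. if n + int m \<ge> 0
                        then fps_nth creation (nat (n + int m)) * fps_nth (annihilation f) m
                        else 0)"

definition schurQ :: "nat list \<Rightarrow> gamma" where
  "schurQ \<nu> = foldr (\<lambda>k. vertexQ (int k)) \<nu> 1"

definition gser :: "gamma fps" where
  "gser = gexp (Abs_fps (\<lambda>n. if odd n then const (2 * (qvar ^ n - 1) / of_nat n) * psum n else 0))"

definition g_part :: "nat list \<Rightarrow> gamma" where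
  "g_part \<mu> = prod_list (map (fps_nth gser) \<mu>)"


section \<open>Characters of the Hecke-Clifford algebra\<close>

text \<open>\<open>\<zeta>\<^sup>\<nu>\<^sub>\<mu>(q)\<close> for a strict partition \<open>\<nu>\<close> and a partition \<open>\<mu>\<close> of the same size, obtained
  from the Frobenius formula by pairing with \<open>Q\<^sub>\<nu>\<close>.\<close>

definition zeta :: "nat list \<Rightarrow> nat list \<Rightarrow> Qq" where
  "zeta \<nu> \<mu> = gform (g_part \<mu>) (schurQ \<nu>)
                / (2 ^ (num_parts \<nu> div 2) * (qvar - 1) ^ num_parts \<mu>)"


section \<open>The polynomials \<open>c\<^sub>i(\<mu>; t)\<close>\<close>

text \<open>The polynomial \<open>(k)\<^sub>t\<close> is represented by its value at \<open>t\<close> in a field, given by the quotient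
  formula provided \<open>t \<noteq> -1\<close>; it is used at the indeterminate \<open>t = q\<close> of \<open>\<rat>(q)\<close>.\<close>

definition tnum :: "nat \<Rightarrow> 'a::field \<Rightarrow> 'a" where
  "tnum k t = (if k = 0 then 1 else (t ^ k - (-1) ^ k) / (t + 1))"

definition tnum_comp :: "nat list \<Rightarrow> 'a::field \<Rightarrow> 'a" where
  "tnum_comp \<tau> t = (\<Prod>a\<leftarrow>\<tau>. tnum a t)"

definition f_comp :: "nat list \<Rightarrow> 'a::field \<Rightarrow> 'a" where
  "f_comp \<tau> t = 2 ^ num_parts \<tau> * (t - 1) ^ num_parts \<tau> * tnum_comp \<tau> t"

definition subcomps :: "nat list \<Rightarrow> nat \<Rightarrow> nat list set" where
  "subcomps \<mu> i = {\<tau>. list_all2 (\<le>) \<tau> \<mu> \<and> sum_list \<tau> = i}"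

definition c_poly :: "nat \<Rightarrow> nat list \<Rightarrow> 'a::field \<Rightarrow> 'a" where
  "c_poly i \<mu> t = (\<Sum>\<tau>\<in>subcomps \<mu> i. f_comp \<tau> t * f_comp (map2 (-) \<mu> \<tau>) t)"


section \<open>Well-definedness\<close>

lemma finite_subcomps: "finite (subcomps \<mu> i)"
proof (rule finite_subset)
  show "subcomps \<mu> i \<subseteq> {\<tau>. set \<tau> \<subseteq> {..i} \<and> length \<tau> = length \<mu>}"
    by (auto simp: subcomps_def list_all2_lengthD dest: member_le_sum_list)
  show "finite {\<tau>. set \<tau> \<subseteq> {..i} \<and> length \<tau> = length \<mu>}"
    by (rule finite_lists_length_eq) simp
qed

subsection \<open>The form on power sums\<close>

definition part_expo :: "nat list \<Rightarrow> (nat \<Rightarrow>\<^sub>0 nat)" where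
  "part_expo \<nu> = (\<Sum>i\<leftarrow>\<nu>. Poly_Mapping.single (i div 2) 1)"

lemma psum_part_eq: "psum_part \<nu> = Poly_Mapping.single (part_expo \<nu>) 1"
  by (induction \<nu>) (simp_all add: psum_part_def part_expo_def psum_def mult_single)

lemma lookup_part_expo:
  assumes "\<forall>i\<in>set \<nu>. odd i"
  shows "Poly_Mapping.lookup (part_expo \<nu>) j = count_list \<nu> (2 * j + 1)"
  using assms
proof (induction \<nu>)
  case (Cons a \<nu>)
  then have "a div 2 = j \<longleftrightarrow> a = 2 * j + 1" by (auto elim!: oddE)
  then show ?case using Cons by (auto simp: part_expo_def lookup_add lookup_single when_def)
qed (simp add: part_expo_def)

lemma mono_norm_part_expo:
  assumes "\<forall>i\<in>set \<nu>. odd i"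
  shows "mono_norm (part_expo \<nu>) = of_nat (z_part \<nu>) / 2 ^ num_parts \<nu>"
proof -
  have bij: "bij_betw (\<lambda>j. 2 * j + 1) (Poly_Mapping.keys (part_expo \<nu>)) (set \<nu>)"
  proof (rule bij_betwI[where g = "\<lambda>i. i div 2"])
    show "(\<lambda>j. 2 * j + 1) \<in> Poly_Mapping.keys (part_expo \<nu>) \<rightarrow> set \<nu>"
      using lookup_part_expo[OF assms] by (auto simp: in_keys_iff count_list_0_iff)
    show "(\<lambda>i. i div 2) \<in> set \<nu> \<rightarrow> Poly_Mapping.keys (part_expo \<nu>)"
      using lookup_part_expo[OF assms] assms by (auto simp: in_keys_iff count_list_0_iff)
  qed (use assms in auto)
  have "z_part \<nu> = (\<Prod>j\<in>Poly_Mapping.keys (part_expo \<nu>). (2 * j + 1) ^ Poly_Mapping.lookup (part_expo \<nu>) j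
                       * fact (Poly_Mapping.lookup (part_expo \<nu>) j))"
    unfolding z_part_def lookup_part_expo[OF assms]
    by (rule prod.reindex_bij_betw[OF bij, symmetric])
  moreover have "num_parts \<nu> = length \<nu>"
    proof -
    have "filter (\<lambda>i. i \<noteq> 0) \<nu> = \<nu>" using assms by (intro filter_True) (auto intro: odd_pos)
    then show ?thesis by (simp add: num_parts_def)
  qed
  moreover have "(\<Sum>j\<in>Poly_Mapping.keys (part_expo \<nu>). Poly_Mapping.lookup (part_expo \<nu>) j) = (\<Sum>i\<in>set \<nu>. count_list \<nu> i)"
    unfolding lookup_part_expo[OF assms]
    by (rule sum.reindex_bij_betw[OF bij])
  ultimately show ?thesis
    by (simp add: mono_norm_def sum_count_set)
qed

lemma part_expo_inj:
  assumes "\<nu> \<in> odd_partitions n" "\<mu> \<in> odd_partitions m" "part_expo \<nu> = part_expo \<mu>"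
  shows "\<nu> = \<mu>"
proof -
  have odd: "\<forall>i\<in>set \<nu>. odd i" "\<forall>i\<in>set \<mu>. odd i"
    using assms by (auto simp: odd_partitions_def)
  have "count_list \<nu> i = count_list \<mu> i" for i
  proof (cases "odd i")
    case True
    then obtain j where "i = 2 * j + 1" by (auto elim: oddE)
    then show ?thesis
      using lookup_part_expo[OF odd(1), of j] lookup_part_expo[OF odd(2), of j] assms(3) by simp
  next
    case False
    then have "i \<notin> set \<nu>" "i \<notin> set \<mu>" using odd by auto
    then show ?thesis by (simp add: count_list_0_iff)
  qed
  then have "mset (rev \<nu>) = mset (rev \<mu>)"
    by (intro multiset_eqI) (simp add: count_mset)
  moreover have "sorted (rev \<nu>)" "sorted (rev \<mu>)"
    using assms by (auto simp: odd_partitions_def partitions_def sorted_wrt_rev)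
  ultimately have "rev \<nu> = rev \<mu>"
    by (metis properties_for_sort sorted_sort_id)
  then show ?thesis by simp
qed

lemma gform_psum_part:
  assumes "\<nu> \<in> odd_partitions n" "\<mu> \<in> odd_partitions m"
  shows "gform (psum_part \<nu>) (psum_part \<mu>) =
           (if \<nu> = \<mu> then of_nat (z_part \<nu>) / 2 ^ num_parts \<nu> else 0)"
proof -
  have "\<forall>i\<in>set \<nu>. odd i" using assms by (auto simp: odd_partitions_def)
  then show ?thesis
    using part_expo_inj[OF assms] mono_norm_part_expo[of \<nu>]
    by (cases "\<nu> = \<mu>") (auto simp: gform_def psum_part_eq intro!: sum.neutral)
qed

subsection \<open>Finiteness of the sum in \<open>vertexQ\<close>\<close>

definition mono_deg :: "(nat \<Rightarrow>\<^sub>0 nat) \<Rightarrow> nat" where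
  "mono_deg e = (\<Sum>j\<in>Poly_Mapping.keys e. (2 * j + 1) * Poly_Mapping.lookup e j)"

lemma mono_deg_minus:
  assumes "Poly_Mapping.lookup e j \<noteq> 0"
  shows "mono_deg (e - Poly_Mapping.single j 1) + (2 * j + 1) = mono_deg e"
proof -
  let ?e' = "e - Poly_Mapping.single j 1"
  have j: "j \<in> Poly_Mapping.keys e" using assms by (simp add: in_keys_iff)
  have "Poly_Mapping.keys ?e' \<subseteq> Poly_Mapping.keys e" by (auto simp: in_keys_iff lookup_minus)
  then have "mono_deg ?e' = (\<Sum>i\<in>Poly_Mapping.keys e. (2 * i + 1) * Poly_Mapping.lookup ?e' i)"
    unfolding mono_deg_def by (intro sum.mono_neutral_left) (auto simp: in_keys_iff)
  also have "\<dots> = (2 * j + 1) * Poly_Mapping.lookup ?e' j + (\<Sum>i\<in>Poly_Mapping.keys e - {j}. (2 * i + 1) * Poly_Mapping.lookup ?e' i)"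
    using j by (simp add: sum.remove)
  also have "(\<Sum>i\<in>Poly_Mapping.keys e - {j}. (2 * i + 1) * Poly_Mapping.lookup ?e' i) =
             (\<Sum>i\<in>Poly_Mapping.keys e - {j}. (2 * i + 1) * Poly_Mapping.lookup e i)"
    by (intro sum.cong) (auto simp: lookup_minus lookup_single)
  finally have 1: "mono_deg ?e' = (2 * j + 1) * (Poly_Mapping.lookup e j - 1) +
                     (\<Sum>i\<in>Poly_Mapping.keys e - {j}. (2 * i + 1) * Poly_Mapping.lookup e i)"
    by (simp add: lookup_minus)
  have 2: "mono_deg e = (2 * j + 1) * Poly_Mapping.lookup e j + (\<Sum>i\<in>Poly_Mapping.keys e - {j}. (2 * i + 1) * Poly_Mapping.lookup e i)"
    unfolding mono_deg_def using j by (simp add: sum.remove)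
  obtain k where "Poly_Mapping.lookup e j = Suc k" using assms not0_implies_Suc by blast
  with 1 2 show ?thesis by (simp add: algebra_simps)
qed

lemma keys_dpsum:
  assumes "odd n" "e' \<in> Poly_Mapping.keys (dpsum n f)"
  shows "\<exists>e\<in>Poly_Mapping.keys f. mono_deg e' + n = mono_deg e"
proof -
  have "Poly_Mapping.keys (dpsum n f) \<subseteq>
        (\<Union>e\<in>Poly_Mapping.keys f. Poly_Mapping.keys (Poly_Mapping.single (e - Poly_Mapping.single (n div 2) 1)
                    (of_nat (Poly_Mapping.lookup e (n div 2)) * Poly_Mapping.lookup f e)))"
    unfolding dpsum_def by (rule keys_sum)
  with assms(2) obtain e where e: "e \<in> Poly_Mapping.keys f"
    "e' \<in> Poly_Mapping.keys (Poly_Mapping.single (e - Poly_Mapping.single (n div 2) 1)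
                  (of_nat (Poly_Mapping.lookup e (n div 2)) * Poly_Mapping.lookup f e))" by blast
  then have "e' = e - Poly_Mapping.single (n div 2) 1" "Poly_Mapping.lookup e (n div 2) \<noteq> 0"
    by (auto split: if_splits)
  with mono_deg_minus[of e "n div 2"] assms(1) e(1) show ?thesis
    by (auto intro!: bexI[of _ e])
qed

lemma annihilation_degree:
  assumes "\<forall>e\<in>Poly_Mapping.keys f. mono_deg e \<le> N"
    and "e \<in> Poly_Mapping.keys (fps_nth ((annihilation_log ^^ j) (fps_const f)) m)"
  shows "mono_deg e + m \<le> N"
  using assms(2)
proof (induction j arbitrary: e m)
  case 0
  then show ?case using assms(1) by (auto split: if_splits)
next
  case (Suc j)
  let ?F = "(annihilation_log ^^ j) (fps_const f)"
  let ?S = "\<Sum>n | odd n \<and> n \<le> m. dpsum n (fps_nth ?F (m - n))"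
  have "fps_nth ((annihilation_log ^^ Suc j) (fps_const f)) m = - ?S"
    unfolding funpow.simps o_apply annihilation_log_def[of ?F] by (rule fps_nth_Abs_fps)
  with Suc.prems have "e \<in> Poly_Mapping.keys ?S"
    by (simp only: in_keys_iff lookup_uminus neg_equal_0_iff_equal simp_thms)
  then have "e \<in> (\<Union>n\<in>{n. odd n \<and> n \<le> m}. Poly_Mapping.keys (dpsum n (fps_nth ?F (m - n))))"
    using set_mp[OF keys_sum] by fast
  then obtain n where n: "odd n" "n \<le> m" "e \<in> Poly_Mapping.keys (dpsum n (fps_nth ?F (m - n)))"
    by blast
  obtain e' where e': "e' \<in> Poly_Mapping.keys (fps_nth ?F (m - n))" "mono_deg e + n = mono_deg e'"
    using keys_dpsum[OF n(1,3)] by blast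
  from Suc.IH[OF e'(1)] e'(2) n(2) show ?case by linarith
qed

lemma finite_vertexQ_support:
  "finite {m. (if n + int m \<ge> 0
               then fps_nth creation (nat (n + int m)) * fps_nth (annihilation f) m else 0) \<noteq> 0}"
proof -
  define N where "N = Max (insert 0 (mono_deg ` Poly_Mapping.keys f))"
  have N: "\<forall>e\<in>Poly_Mapping.keys f. mono_deg e \<le> N" by (auto simp: N_def)
  have "fps_nth (annihilation f) m = 0" if "m > N" for m
  proof -
    have "Poly_Mapping.keys (fps_nth ((annihilation_log ^^ j) (fps_const f)) m) = {}" for j
      using annihilation_degree[OF N, of _ j m] that by fastforce
    then show ?thesis by (simp add: annihilation_def)
  qed
  then show ?thesis
    by (intro finite_subset[OF _ finite_atMost[of N]] subsetI)
       (metis (mono_tags, lifting) CollectD atMost_iff linorder_not_less mult_zero_right)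
qed

end

theory Submission
  imports Defs
begin

text \<open>
  Write \<open>q\<^sub>l\<close> for the coefficients of the creation series, and \<open>f\<^sub>m(t)\<close> for \<open>f_comp [m] t\<close>, the
  coefficients of \<open>(1 + t x) (1 - x) / ((1 - t x) (1 + x))\<close>.  The annihilation series shifts
  \<open>p\<^sub>n\<close> by \<open>- z\<^sup>-\<^sup>n\<close> and so multiplies \<open>\<Sum>\<^sub>l q\<^sub>l w\<^sup>l\<close> by \<open>(1 - w/z) / (1 + w/z)\<close>, which gives
  \<open>Q\<^bsub>(k,l)\<^esub> = q\<^sub>k q\<^sub>l + 2 \<Sum>\<^sub>m\<^sub>\<ge>\<^sub>1 (-1)\<^sup>m q\<^sub>k\<^sub>+\<^sub>m q\<^sub>l\<^sub>-\<^sub>m\<close>.  Pairing with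
  \<open>q\<^sub>i q\<^sub>j\<close> extracts the coefficient of \<open>x\<^sup>i y\<^sup>j\<close> after the substitution \<open>p\<^sub>n = x\<^sup>n + y\<^sup>n\<close>,
  because multiplication by \<open>p\<^sub>n\<close> is adjoint to \<open>(n/2) \<partial>/\<partial>p\<^sub>n\<close>.  This substitution turns \<open>g\<^sub>m\<close> into
  \<open>\<Sum>\<^sub>\<tau> f\<^sub>\<tau>(q) f\<^sub>m\<^sub>-\<^sub>\<tau>(q) x\<^sup>\<tau> y\<^sup>m\<^sup>-\<^sup>\<tau>\<close>, hence \<open>\<langle>g\<^sub>\<mu>, q\<^sub>i q\<^sub>j\<rangle> = c\<^sub>i(\<mu>; q)\<close> for \<open>i + j = |\<mu>|\<close>.  All
  exponentials are handled through the recurrences given by their logarithmic derivatives.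
\<close>

section \<open>The coefficients of the exponential series\<close>

lemma sum_odd_indices:
  fixes g :: "nat \<Rightarrow> 'a::comm_monoid_add"
  shows "(\<Sum>n | odd n \<and> n \<le> m. g n) = (\<Sum>k<Suc m div 2. g (2 * k + 1))"
  by (rule sum.reindex_bij_witness[where i = "\<lambda>k. 2 * k + 1" and j = "\<lambda>n. n div 2"])
     (auto elim!: oddE)

lemma sum_odd_support:
  fixes g :: "nat \<Rightarrow> 'a::comm_monoid_add"
  assumes "\<And>n. even n \<Longrightarrow> g n = 0"
  shows "(\<Sum>n\<le>m. g n) = (\<Sum>n | odd n \<and> n \<le> m. g n)"
  by (rule sum.mono_neutral_right) (use assms in auto)

lemma f_comp_Cons: "f_comp (m # \<tau>) t = f_comp [m] t * f_comp \<tau> t"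
  by (simp add: f_comp_def num_parts_def tnum_comp_def)

lemma f_comp_zero [simp]: "f_comp [0] t = 1"
  by (simp add: f_comp_def num_parts_def tnum_comp_def tnum_def)

lemma f_comp_pos: "m > 0 \<Longrightarrow> f_comp [m] t = 2 * (t - 1) / (t + 1) * (t ^ m - (-1) ^ m)"
  by (simp add: f_comp_def num_parts_def tnum_comp_def tnum_def)

text \<open>The logarithmic derivative of \<open>(1 + t x) (1 - x) / ((1 - t x) (1 + x))\<close> times \<open>x\<close> is
  \<open>\<Sum>\<^bsub>n odd\<^esub> 2 (t\<^sup>n - 1) x\<^sup>n\<close>.\<close>

lemma f_comp_rec:
  fixes t :: "'a::field"
  assumes t: "t + 1 \<noteq> 0"
  shows "of_nat m * f_comp [m] t = (\<Sum>n | odd n \<and> n \<le> m. 2 * (t ^ n - 1) * f_comp [m - n] t)"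
    (is "_ = ?S")
proof -
  define u where "u = 2 * (t - 1) / (t + 1)"
  have S: "?S = (\<Sum>k<Suc m div 2. 2 * (t ^ (2 * k + 1) - 1) * f_comp [m - (2 * k + 1)] t)"
    by (rule sum_odd_indices)
  show ?thesis
  proof (cases "m = 0")
    case False
    then consider K where "m = 2 * K" "K > 0" | K where "m = 2 * K + 1"
      by (metis evenE oddE mult_0_right not_gr_zero)
    then show ?thesis
    proof cases
      case 1
      \<comment> \<open>The odd powers of \<open>t\<close> produced here cancel in the sum under the
        reflection of \<open>k\<close> to \<open>K - Suc k\<close>.\<close>
      have "2 * (t ^ (2 * k + 1) - 1) * f_comp [m - (2 * k + 1)] t =
            2 * u * ((t ^ m - 1) + (t ^ (2 * k + 1) - t ^ (2 * (K - Suc k) + 1)))" if "k < K" for k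
      proof -
        have e: "m - (2 * k + 1) = 2 * (K - Suc k) + 1" "m = (2 * k + 1) + (2 * (K - Suc k) + 1)"
          using that 1 by auto
        have "f_comp [m - (2 * k + 1)] t = u * (t ^ (2 * (K - Suc k) + 1) + 1)"
          unfolding e(1) by (subst f_comp_pos) (simp_all add: u_def)
        moreover have "t ^ m = t ^ (2 * k + 1) * t ^ (2 * (K - Suc k) + 1)"
          unfolding e(2) by (rule power_add)
        ultimately show ?thesis by (simp only:) (simp add: algebra_simps)
      qed
      then have "?S = (\<Sum>k<K. 2 * u * ((t ^ m - 1) + (t ^ (2 * k + 1) - t ^ (2 * (K - Suc k) + 1))))"
        unfolding S using 1 by (intro sum.cong) auto
      also have "\<dots> = 2 * u * (of_nat K * (t ^ m - 1) +
                   ((\<Sum>k<K. t ^ (2 * k + 1)) - (\<Sum>k<K. t ^ (2 * (K - Suc k) + 1))))"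
        by (simp add: sum.distrib sum_subtractf flip: sum_distrib_left)
      also have "(\<Sum>k<K. t ^ (2 * (K - Suc k) + 1)) = (\<Sum>k<K. t ^ (2 * k + 1))"
        by (rule sum.nat_diff_reindex)
      finally show ?thesis using 1 f_comp_pos[of m t] by (simp add: u_def)
    next
      case 2
      \<comment> \<open>For odd \<open>m\<close> the leftover exponents, odd and even together, fill
        the range from \<open>1\<close> to \<open>2 * K\<close> and form one geometric sum.\<close>
      have geo: "(t - 1) * (\<Sum>k<K. t ^ (2 * k + 1) + t ^ (2 * Suc k)) = t ^ m - t"
        unfolding 2 by (induction K) (simp_all add: algebra_simps power2_eq_square)
      have "2 * (t ^ (2 * k + 1) - 1) * f_comp [m - (2 * k + 1)] t =
            2 * u * ((t ^ m + 1) - (t ^ (2 * k + 1) + t ^ (2 * Suc (K - Suc k))))" if "k < K" for k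
      proof -
        have e: "m - (2 * k + 1) = 2 * Suc (K - Suc k)" "m = (2 * k + 1) + 2 * Suc (K - Suc k)"
          using that 2 by auto
        have "f_comp [m - (2 * k + 1)] t = u * (t ^ (2 * Suc (K - Suc k)) - 1)"
          unfolding e(1) by (subst f_comp_pos) (simp_all add: u_def)
        moreover have "t ^ m = t ^ (2 * k + 1) * t ^ (2 * Suc (K - Suc k))"
          unfolding e(2) by (rule power_add)
        ultimately show ?thesis by (simp only:) (simp add: algebra_simps)
      qed
      \<comment> \<open>The last index \<open>k = K\<close> breaks the pattern, as
        \<open>f_comp [0] t\<close> is \<open>1\<close> and not the value \<open>0\<close> of the
        general formula; it gives the separate summand.\<close>
      then have "?S = (\<Sum>k<K. 2 * u * ((t ^ m + 1) - (t ^ (2 * k + 1) + t ^ (2 * Suc (K - Suc k)))))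
                       + 2 * (t ^ m - 1)"
        unfolding S using 2 by (simp cong: sum.cong_simp)
      also have "(\<Sum>k<K. 2 * u * ((t ^ m + 1) - (t ^ (2 * k + 1) + t ^ (2 * Suc (K - Suc k))))) =
          2 * u * (of_nat K * (t ^ m + 1) -
             ((\<Sum>k<K. t ^ (2 * k + 1)) + (\<Sum>k<K. t ^ (2 * Suc (K - Suc k)))))"
        by (simp only: sum.distrib sum_subtractf sum_constant card_lessThan distrib_left mult_1_right flip: sum_distrib_left)
      also have "(\<Sum>k<K. t ^ (2 * Suc (K - Suc k))) = (\<Sum>k<K. t ^ (2 * Suc k))"
        by (rule sum.nat_diff_reindex)
      also have "(\<Sum>k<K. t ^ (2 * k + 1)) + (\<Sum>k<K. t ^ (2 * Suc k)) =
                 (\<Sum>k<K. t ^ (2 * k + 1) + t ^ (2 * Suc k))" by (simp only: sum.distrib)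
      finally have "?S * (t + 1) = 4 * ((t - 1) * of_nat K * (t ^ m + 1) - (t ^ m - t))
                       + 2 * (t ^ m - 1) * (t + 1)"
        unfolding u_def geo[symmetric] using t by (simp add: field_simps)
      also have "\<dots> = of_nat m * (2 * (t - 1) * (t ^ m + 1))"
        by (simp add: 2 algebra_simps)
      also have "2 * (t - 1) * (t ^ m + 1) = f_comp [m] t * (t + 1)"
        using t f_comp_pos[of m t] by (simp add: 2)
      finally have "?S * (t + 1) = of_nat m * f_comp [m] t * (t + 1)" by (simp only: mult.assoc)
      then show ?thesis using t by simp
    qed
  qed simp
qed

text \<open>The sequence \<open>c\<close> stands for \<open>1 / j!\<close>. Keeping it abstract lets
  one argument serve both series over \<open>gamma\<close>, a ring without division, and series of
  scalars.\<close>

definition trunc_exp :: "(nat \<Rightarrow> 'a) \<Rightarrow> 'a::comm_ring_1 fps \<Rightarrow> 'a fps" where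
  "trunc_exp c F = Abs_fps (\<lambda>m. \<Sum>j\<le>m. c j * fps_nth (F ^ j) m)"

lemma trunc_exp_nth_0: "fps_nth (trunc_exp c F) 0 = c 0"
  by (simp add: trunc_exp_def)

text \<open>The hypothesis on \<open>c\<close> makes the derivative of term \<open>j + 1\<close>
  equal to \<open>fps_deriv F\<close> times term \<open>j\<close>.\<close>

lemma fps_XD_trunc_exp:
  fixes F :: "'a::comm_ring_1 fps"
  assumes F: "fps_nth F 0 = 0" and c: "\<And>j. of_nat (Suc j) * c (Suc j) = c j"
  shows "fps_XD (trunc_exp c F) = fps_XD F * trunc_exp c F"
proof -
  have "fps_nth (fps_deriv (trunc_exp c F)) m = fps_nth (fps_deriv F * trunc_exp c F) m" for m
  proof -
    \<comment> \<open>Powers \<open>F ^ j\<close> with \<open>j > N\<close> do not reach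
      coefficients up to \<open>N\<close>, so there the polynomial \<open>P N\<close> in
      \<open>F\<close> replaces the series and can be differentiated termwise.\<close>
    define P where "P N = (\<Sum>j\<le>N. fps_const (c j) * F ^ j)" for N
    have P: "fps_nth (trunc_exp c F) i = fps_nth (P N) i" if "i \<le> N" for i N
    proof -
      have "fps_nth (P N) i = (\<Sum>j\<le>N. c j * fps_nth (F ^ j) i)" by (simp add: P_def fps_sum_nth)
      also have "\<dots> = (\<Sum>j\<le>i. c j * fps_nth (F ^ j) i)"
        using that F by (intro sum.mono_neutral_right) (auto simp: startsby_zero_power_prefix)
      finally show ?thesis by (simp add: trunc_exp_def)
    qed
    have dP: "fps_deriv (P (Suc N)) = fps_deriv F * P N" for N
    proof -
      have "fps_deriv (P (Suc N)) = (\<Sum>j\<le>Suc N. fps_const (c j) * fps_deriv (F ^ j))"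
        by (simp add: P_def fps_deriv_sum)
      also have "\<dots> = (\<Sum>j\<le>N. fps_const (c (Suc j)) * fps_deriv (F ^ Suc j))"
        by (subst sum.atMost_Suc_shift) simp
      also have "fps_const (c (Suc j)) * fps_deriv (F ^ Suc j) = fps_deriv F * (fps_const (c j) * F ^ j)" for j
      proof -
        have "fps_const (c j) = fps_const (of_nat (Suc j)) * fps_const (c (Suc j))"
          by (simp only: c fps_const_mult)
        then show ?thesis by (simp only: fps_deriv_power diff_Suc_1 mult.assoc mult.left_commute mult.commute)
      qed
      then have "(\<Sum>j\<le>N. fps_const (c (Suc j)) * fps_deriv (F ^ Suc j)) = fps_deriv F * P N"
        unfolding P_def sum_distrib_left by (intro sum.cong) auto
      finally show ?thesis .
    qed
    have "fps_nth (fps_deriv (trunc_exp c F)) m = fps_nth (fps_deriv (P (Suc m))) m"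
      by (simp add: P[of "Suc m" "Suc m"])
    also have "\<dots> = fps_nth (fps_deriv F * trunc_exp c F) m"
      unfolding dP fps_mult_nth by (intro sum.cong) (auto simp: P[of _ m])
    finally show ?thesis .
  qed
  then have "fps_deriv (trunc_exp c F) = fps_deriv F * trunc_exp c F" by (rule fps_ext)
  then show ?thesis by (simp add: fps_XD_def mult.assoc)
qed

lemma trunc_exp_rec:
  fixes F :: "'a::comm_ring_1 fps"
  assumes "fps_nth F 0 = 0" "\<And>j. of_nat (Suc j) * c (Suc j) = c j"
  shows "of_nat m * fps_nth (trunc_exp c F) m =
           (\<Sum>n\<le>m. of_nat n * fps_nth F n * fps_nth (trunc_exp c F) (m - n))"
  using arg_cong[OF fps_XD_trunc_exp[OF assms], of "\<lambda>f. fps_nth f m"]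
  by (simp add: fps_mult_nth atLeast0AtMost mult.assoc)

section \<open>Derivations and the bilinear form\<close>

lemma const_simps [simp]:
  "const 0 = 0" "const 1 = 1" "const (a + b) = const a + const b" "const (- a) = - const a"
  "const (a * b) = const a * const b" "const (of_nat n) = of_nat n" "const (numeral w) = numeral w"
  by (simp_all add: const_def single_add single_uminus mult_single)

lemma const_sum: "const (\<Sum>i\<in>A. g i) = (\<Sum>i\<in>A. const (g i))"
  by (induction A rule: infinite_finite_induct) simp_all

lemma of_nat_const_divide: "n > 0 \<Longrightarrow> of_nat n * const (a / of_nat n) = const a"
  by (simp flip: const_simps(5,6))

lemma lookup_const_mult [simp]:
  "Poly_Mapping.lookup (const c * f) e = c * Poly_Mapping.lookup f e"
  unfolding const_def mult_map_scale_conv_mult[symmetric]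
  by (simp add: Poly_Mapping.map.rep_eq when_def)

text \<open>Reduces additive claims to monomials; the product rule and the adjointness below are
  proved this way.\<close>

lemma poly_mapping_additive_induct [case_names zero single add]:
  assumes "P 0" "\<And>e c. P (Poly_Mapping.single e c)" "\<And>f g. P f \<Longrightarrow> P g \<Longrightarrow> P (f + g)"
  shows "P (f :: 'a \<Rightarrow>\<^sub>0 'b::comm_monoid_add)"
proof -
  have "f = (\<Sum>e\<in>Poly_Mapping.keys f. Poly_Mapping.single e (Poly_Mapping.lookup f e))"
    by (rule poly_mapping_eqI) (simp add: lookup_sum lookup_single when_def in_keys_iff)
  moreover have "P (\<Sum>e\<in>A. Poly_Mapping.single e (Poly_Mapping.lookup f e))" for A
    by (induction A rule: infinite_finite_induct) (simp_all add: assms)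
  ultimately show ?thesis by metis
qed

lemma lookup_dpsum:
  "Poly_Mapping.lookup (dpsum n f) e =
     of_nat (Suc (Poly_Mapping.lookup e (n div 2))) *
     Poly_Mapping.lookup f (e + Poly_Mapping.single (n div 2) 1)"
proof -
  let ?s = "Poly_Mapping.single (n div 2) (1::nat)"
  \<comment> \<open>Truncated subtraction also fixes vectors with exponent \<open>0\<close> at
    \<open>n div 2\<close>, but their terms carry the factor \<open>0\<close>; only
    \<open>e + ?s\<close> contributes.\<close>
  have eq: "e' = e + ?s" if "e' - ?s = e" "Poly_Mapping.lookup e' (n div 2) \<noteq> 0" for e'
    using that by (auto intro!: poly_mapping_eqI simp: lookup_add lookup_minus lookup_single when_def)
  have "Poly_Mapping.lookup (dpsum n f) e = (\<Sum>e'\<in>Poly_Mapping.keys f.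
          of_nat (Poly_Mapping.lookup e' (n div 2)) * Poly_Mapping.lookup f e' when e' - ?s = e)"
    by (simp add: dpsum_def lookup_sum lookup_single)
  also have "\<dots> = (\<Sum>e'\<in>Poly_Mapping.keys f.
          if e' = e + ?s then of_nat (Suc (Poly_Mapping.lookup e (n div 2))) * Poly_Mapping.lookup f (e + ?s) else 0)"
    using eq by (intro sum.cong) (auto simp: when_def lookup_add)
  also have "\<dots> = of_nat (Suc (Poly_Mapping.lookup e (n div 2))) * Poly_Mapping.lookup f (e + ?s)"
    by (simp add: in_keys_iff)
  finally show ?thesis .
qed

lemma dpsum_add: "dpsum n (f + g) = dpsum n f + dpsum n g"
  by (rule poly_mapping_eqI) (simp add: lookup_dpsum lookup_add algebra_simps)

lemma dpsum_zero [simp]: "dpsum n 0 = 0"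
  by (simp add: dpsum_def)

lemma dpsum_sum: "dpsum n (\<Sum>i\<in>A. g i) = (\<Sum>i\<in>A. dpsum n (g i))"
  by (induction A rule: infinite_finite_induct) (simp_all add: dpsum_add)

lemma dpsum_const_mult [simp]: "dpsum n (const c * f) = const c * dpsum n f"
  by (rule poly_mapping_eqI) (simp add: lookup_dpsum)

lemma dpsum_single:
  "dpsum n (Poly_Mapping.single e c) = Poly_Mapping.single (e - Poly_Mapping.single (n div 2) 1)
     (of_nat (Poly_Mapping.lookup e (n div 2)) * c)"
  by (simp add: dpsum_def)

lemma dpsum_one [simp]: "dpsum n 1 = 0"
  unfolding single_one[symmetric] dpsum_single by simp

lemma dpsum_psum: "odd n \<Longrightarrow> odd k \<Longrightarrow> dpsum n (psum k) = (if k = n then 1 else 0)"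
  by (auto simp: psum_def dpsum_single lookup_single when_def elim!: oddE)

lemma dpsum_mult: "dpsum n (f * g) = dpsum n f * g + f * dpsum n g"
proof (induction f rule: poly_mapping_additive_induct)
  case (single a c)
  show ?case
  proof (induction g rule: poly_mapping_additive_induct)
    case (single b d)
    let ?s = "Poly_Mapping.single (n div 2) (1::nat)"
    have "a + b - ?s = (a - ?s) + b" if "Poly_Mapping.lookup a (n div 2) \<noteq> 0"
      using that by (auto intro!: poly_mapping_eqI simp: lookup_add lookup_minus lookup_single when_def)
    moreover have "a + b - ?s = a + (b - ?s)" if "Poly_Mapping.lookup b (n div 2) \<noteq> 0"
      using that by (auto intro!: poly_mapping_eqI simp: lookup_add lookup_minus lookup_single when_def)
    ultimately show ?case
      by (cases "Poly_Mapping.lookup a (n div 2) = 0"; cases "Poly_Mapping.lookup b (n div 2) = 0")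
         (simp_all add: mult_single dpsum_single lookup_add algebra_simps flip: single_add)
  qed (simp_all add: dpsum_add algebra_simps)
qed (simp_all add: dpsum_add algebra_simps)

section \<open>The bilinear form and adjointness\<close>

lemma gform_superset:
  assumes "finite S" "Poly_Mapping.keys f \<subseteq> S"
  shows "gform f g = (\<Sum>e\<in>S. Poly_Mapping.lookup f e * Poly_Mapping.lookup g e * mono_norm e)"
  unfolding gform_def by (rule sum.mono_neutral_left) (use assms in \<open>auto simp: in_keys_iff\<close>)

lemma gform_commute: "gform f g = gform g f"
  by (simp add: gform_def Int_commute mult.commute)

lemma gform_zero [simp]: "gform 0 g = 0" "gform g 0 = 0"
  by (simp_all add: gform_def)

lemma gform_one_one [simp]: "gform 1 1 = 1"
  by (simp add: gform_def mono_norm_def)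

lemma gform_add_left: "gform (f + f') g = gform f g + gform f' g"
proof -
  let ?S = "Poly_Mapping.keys f \<union> Poly_Mapping.keys f'"
  have "Poly_Mapping.keys (f + f') \<subseteq> ?S" by (rule keys_add)
  then show ?thesis
    by (simp add: gform_superset[of ?S] lookup_add distrib_right sum.distrib)
qed

lemma gform_const_mult_left [simp]: "gform (const c * f) g = c * gform f g"
proof -
  have "Poly_Mapping.keys (const c * f) \<subseteq> Poly_Mapping.keys f" by (auto simp: in_keys_iff)
  then show ?thesis
    by (simp add: gform_superset[of "Poly_Mapping.keys f"] sum_distrib_left mult.assoc)
qed

lemma gform_sum_left: "gform (\<Sum>i\<in>A. f i) g = (\<Sum>i\<in>A. gform (f i) g)"
  by (induction A rule: infinite_finite_induct) (simp_all add: gform_add_left)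

lemma gform_add_right: "gform f (g + g') = gform f g + gform f g'"
  by (simp add: gform_commute[of f] gform_add_left)

lemma gform_const_mult_right [simp]: "gform f (const c * g) = c * gform f g"
  by (simp add: gform_commute[of f])

lemma gform_sum_right: "gform f (\<Sum>i\<in>A. g i) = (\<Sum>i\<in>A. gform f (g i))"
  by (simp add: gform_commute[of f] gform_sum_left)

lemma mono_norm_superset:
  assumes "finite S" "Poly_Mapping.keys e \<subseteq> S"
  shows "mono_norm e = (\<Prod>j\<in>S. of_nat ((2 * j + 1) ^ Poly_Mapping.lookup e j * fact (Poly_Mapping.lookup e j))
                                   / 2 ^ Poly_Mapping.lookup e j)"
  unfolding mono_norm_def of_nat_prod power_sum prod_dividef[symmetric]
  by (rule prod.mono_neutral_left) (use assms in \<open>auto simp: in_keys_iff\<close>)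

lemma mono_norm_add_single:
  "mono_norm (e + Poly_Mapping.single j 1) =
     of_nat (2 * j + 1) / 2 * of_nat (Suc (Poly_Mapping.lookup e j)) * mono_norm e"
proof -
  let ?S = "insert j (Poly_Mapping.keys e)" and ?e = "e + Poly_Mapping.single j 1"
  define h :: "nat \<Rightarrow> nat \<Rightarrow> Qq"
    where "h i k = of_nat ((2 * i + 1) ^ k * fact k) / 2 ^ k" for i k
  have "Poly_Mapping.keys ?e \<subseteq> ?S"
    by (auto simp: in_keys_iff lookup_add lookup_single when_def split: if_splits)
  then have 1: "mono_norm ?e = (\<Prod>i\<in>?S. h i (Poly_Mapping.lookup ?e i))"
    unfolding h_def by (intro mono_norm_superset) auto
  have 2: "mono_norm e = (\<Prod>i\<in>?S. h i (Poly_Mapping.lookup e i))"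
    unfolding h_def by (intro mono_norm_superset) auto
  have "(\<Prod>i\<in>?S - {j}. h i (Poly_Mapping.lookup ?e i)) = (\<Prod>i\<in>?S - {j}. h i (Poly_Mapping.lookup e i))"
    by (intro prod.cong) (auto simp: lookup_add lookup_single)
  moreover have "h j (Suc k) = of_nat (2 * j + 1) / 2 * of_nat (Suc k) * h j k" for k
    by (simp add: h_def field_simps)
  ultimately show ?thesis
    unfolding 1 2 by (simp add: prod.remove[of ?S j] lookup_add)
qed

text \<open>For a monomial \<open>f\<close>, raising its exponent \<open>m\<close> at
  \<open>p_n\<close> by one multiplies the norm by \<open>n / 2 * (m + 1)\<close>, and
  differentiating \<open>g\<close> supplies the same factor \<open>m + 1\<close>.\<close>

lemma gform_psum_mult:
  assumes "odd n"
  shows "gform (psum n * f) g = of_nat n / 2 * gform f (dpsum n g)"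
proof (induction f rule: poly_mapping_additive_induct)
  case (single e c)
  have n: "2 * (n div 2) + 1 = n" using assms by simp
  have s: "gform (Poly_Mapping.single e c) g = c * Poly_Mapping.lookup g e * mono_norm e" for e c g
    using gform_superset[of "{e}" "Poly_Mapping.single e c" g] by auto
  show ?case
    unfolding psum_def mult_single s lookup_dpsum
    using mono_norm_add_single[of e "n div 2", unfolded n]
    by (simp add: add.commute[of "Poly_Mapping.single _ _"])
qed (simp_all add: gform_add_left distrib_left)

section \<open>The Q-functions of two-part partitions\<close>

lemma inverse_fact_rec: "of_nat (Suc j) * (1 / of_nat (fact (Suc j))) = (1 / of_nat (fact j) :: Qq)"
  by (simp only: fact_Suc of_nat_mult of_nat_id) (simp del: of_nat_Suc)

lemma gexp_rec:
  fixes a :: "nat \<Rightarrow> Qq"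
  defines "E \<equiv> gexp (Abs_fps (\<lambda>n. if odd n then const (a n / of_nat n) * psum n else 0))"
  shows "of_nat m * fps_nth E m = (\<Sum>n | odd n \<and> n \<le> m. const (a n) * psum n * fps_nth E (m - n))"
proof -
  define F where "F = Abs_fps (\<lambda>n. if odd n then const (a n / of_nat n) * psum n else 0)"
  have E: "E = trunc_exp (\<lambda>j. const (1 / of_nat (fact j))) F"
    by (simp only: E_def gexp_def trunc_exp_def F_def)
  have c: "of_nat (Suc j) * const (1 / of_nat (fact (Suc j))) = const (1 / of_nat (fact j))" for j
    by (simp only: inverse_fact_rec flip: const_simps(5,6))
  have "of_nat m * fps_nth E m = (\<Sum>n\<le>m. of_nat n * fps_nth F n * fps_nth E (m - n))"
    unfolding E by (rule trunc_exp_rec) (use c in \<open>auto simp: F_def simp del: of_nat_Suc fact_Suc\<close>)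
  also have "\<dots> = (\<Sum>n | odd n \<and> n \<le> m. of_nat n * fps_nth F n * fps_nth E (m - n))"
    by (rule sum_odd_support) (simp add: F_def)
  also have "\<dots> = (\<Sum>n | odd n \<and> n \<le> m. const (a n) * psum n * fps_nth E (m - n))"
    by (rule sum.cong) (auto simp: F_def of_nat_const_divide odd_pos simp flip: mult.assoc)
  finally show ?thesis .
qed

lemma gexp_nth_0: "fps_nth (gexp F) 0 = 1"
  by (simp add: gexp_def)

lemma creation_0 [simp]: "fps_nth creation 0 = 1"
  by (simp add: creation_def gexp_nth_0)

lemma creation_rec:
  "of_nat m * fps_nth creation m = (\<Sum>n | odd n \<and> n \<le> m. const 2 * psum n * fps_nth creation (m - n))"
  unfolding creation_def by (rule gexp_rec)

lemma gser_rec: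
  "of_nat m * fps_nth gser m =
     (\<Sum>n | odd n \<and> n \<le> m. const (2 * (qvar ^ n - 1)) * psum n * fps_nth gser (m - n))"
  unfolding gser_def by (rule gexp_rec)

text \<open>Differentiating the exponent multiplies the creation series by
  \<open>2 / n * z^n\<close>. On coefficients this becomes an induction along
  \<open>creation_rec\<close>.\<close>

lemma dpsum_creation:
  assumes n: "odd n"
  shows "dpsum n (fps_nth creation l) =
           (if n \<le> l then const (2 / of_nat n) * fps_nth creation (l - n) else 0)"
proof (induction l rule: less_induct)
  case (less l)
  let ?q = "fps_nth creation"
  show ?case
  proof (cases "l = 0")
    case True
    then show ?thesis using n by (auto simp: odd_pos)
  next
    case False
    have rest: "(\<Sum>k | odd k \<and> k \<le> l. const 2 * psum k * dpsum n (?q (l - k))) =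
               (if n \<le> l then const (2 / of_nat n) * (of_nat (l - n) * ?q (l - n)) else 0)"
    proof -
      have "(\<Sum>k | odd k \<and> k \<le> l. const 2 * psum k * dpsum n (?q (l - k))) =
            (\<Sum>k | odd k \<and> k \<le> l. if k + n \<le> l then
               const (2 / of_nat n) * (const 2 * psum k * ?q (l - n - k)) else 0)"
        using less False by (intro sum.cong) (auto simp: odd_pos algebra_simps)
      also have "\<dots> = (\<Sum>k\<in>(if n \<le> l then {k. odd k \<and> k \<le> l - n} else {}).
               const (2 / of_nat n) * (const 2 * psum k * ?q (l - n - k)))"
        by (cases "n \<le> l") (auto intro!: sum.mono_neutral_cong_right sum.neutral split: if_splits)
      finally show ?thesis
        unfolding creation_rec
        by (cases "n \<le> l") (simp_all add: sum_distrib_left del: const_simps)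
    qed
    have "of_nat l * dpsum n (?q l) = dpsum n (of_nat l * ?q l)"
      by (simp only: dpsum_const_mult flip: const_simps(6))
    also have "\<dots> = (\<Sum>k | odd k \<and> k \<le> l. const 2 * (dpsum n (psum k) * ?q (l - k))) +
                     (\<Sum>k | odd k \<and> k \<le> l. const 2 * psum k * dpsum n (?q (l - k)))"
      unfolding creation_rec dpsum_sum mult.assoc dpsum_const_mult
      by (simp only: dpsum_mult distrib_left sum.distrib mult.assoc)
    also have "(\<Sum>k | odd k \<and> k \<le> l. const 2 * (dpsum n (psum k) * ?q (l - k))) =
               (\<Sum>k | odd k \<and> k \<le> l. if k = n then const 2 * ?q (l - n) else 0)"
      using n by (intro sum.cong) (auto simp: dpsum_psum)
    also have "\<dots> = (if n \<le> l then const (2 / of_nat n) * (of_nat n * ?q (l - n)) else 0)"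
    proof -
      have "const 2 * ?q (l - n) = const (2 / of_nat n) * (of_nat n * ?q (l - n))"
        unfolding of_nat_const_divide[OF odd_pos[OF n], of 2, symmetric]
        by (simp only: mult.assoc mult.left_commute)
      with n show ?thesis by (subst sum.delta) (simp_all del: const_simps)
    qed
    also note rest
    \<comment> \<open>The weight \<open>l\<close> splits as \<open>n + (l - n)\<close>: the first
      part comes from differentiating \<open>psum n\<close>, the second from the recurrence at
      \<open>l - n\<close>.\<close>
    also have "(if n \<le> l then const (2 / of_nat n) * (of_nat n * ?q (l - n)) else 0) +
          (if n \<le> l then const (2 / of_nat n) * (of_nat (l - n) * ?q (l - n)) else 0) =
        of_nat l * (if n \<le> l then const (2 / of_nat n) * ?q (l - n) else 0)"
    proof (cases "n \<le> l")
      case True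
      then have "of_nat l = (of_nat n + of_nat (l - n) :: gamma)" by (simp flip: of_nat_add)
      with True show ?thesis by (simp only: if_True distrib_left distrib_right mult.left_commute)
    qed simp
    finally have "of_nat l * dpsum n (?q l) =
        of_nat l * (if n \<le> l then const (2 / of_nat n) * ?q (l - n) else 0)" .
    with False show ?thesis by (simp del: const_simps)
  qed
qed

text \<open>At \<open>t = 0\<close> the coefficients \<open>f\<^sub>m(t)\<close> become those of \<open>(1 - x) / (1 + x)\<close>.\<close>

lemma trunc_exp_annihilation:
  "fps_nth (trunc_exp (\<lambda>j. 1 / of_nat (fact j)) (Abs_fps (\<lambda>n. if odd n then - 2 / of_nat n else 0))) m =
     (f_comp [m] 0 :: Qq)"
proof (induction m rule: less_induct)
  case (less m)
  define F :: "Qq fps" where "F = Abs_fps (\<lambda>n. if odd n then - 2 / of_nat n else 0)"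
  define E where "E = trunc_exp (\<lambda>j. 1 / of_nat (fact j)) F"
  have IH: "fps_nth E i = f_comp [i] 0" if "i < m" for i
    using less[OF that] by (simp only: E_def F_def)
  have "fps_nth E m = f_comp [m] 0"
  proof (cases "m = 0")
    case True
    then show ?thesis by (simp add: E_def trunc_exp_nth_0)
  next
    case False
    have "of_nat m * fps_nth E m = (\<Sum>n\<le>m. of_nat n * fps_nth F n * fps_nth E (m - n))"
      unfolding E_def by (rule trunc_exp_rec)
        (use inverse_fact_rec in \<open>auto simp: F_def simp del: of_nat_Suc fact_Suc\<close>)
    also have "\<dots> = (\<Sum>n | odd n \<and> n \<le> m. of_nat n * fps_nth F n * fps_nth E (m - n))"
      by (rule sum_odd_support) (simp add: F_def)
    also have "\<dots> = (\<Sum>n | odd n \<and> n \<le> m. 2 * (0 ^ n - 1) * f_comp [m - n] 0)"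
      using False by (intro sum.cong) (auto simp: F_def IH odd_pos zero_power)
    also have "\<dots> = of_nat m * f_comp [m] 0"
      by (rule f_comp_rec[symmetric]) simp
    finally show ?thesis using False by simp
  qed
  then show ?case by (simp only: E_def F_def)
qed

text \<open>Each derivation lowers the index of a creation coefficient and contributes a scalar. On
  series of this shape \<open>annihilation_log\<close> is therefore multiplication by a scalar
  series \<open>F\<close>, and its exponential is the scalar exponential of
  \<open>F\<close>.\<close>

lemma annihilation_creation:
  "fps_nth (annihilation (fps_nth creation l)) m =
     (if m \<le> l then const (f_comp [m] 0) * fps_nth creation (l - m) else 0)"
proof -
  \<comment> \<open>Extending by \<open>0\<close> beyond \<open>l\<close> makes the shift rule
    \<open>dq\<close> hold for every index.\<close>
  define q where "q m = (if m \<le> l then fps_nth creation (l - m) else 0)" for m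
  define F :: "Qq fps" where "F = Abs_fps (\<lambda>n. if odd n then - 2 / of_nat n else 0)"
  have dq: "dpsum n (q i) = const (2 / of_nat n) * q (n + i)" if "odd n" for n i
    using that by (auto simp: q_def dpsum_creation algebra_simps)
  have step: "annihilation_log (Abs_fps (\<lambda>m. const (fps_nth C m) * q m)) =
              Abs_fps (\<lambda>m. const (fps_nth (F * C) m) * q m)" for C
  proof (rule fps_ext)
    fix m
    have "fps_nth (F * C) m = (\<Sum>n | odd n \<and> n \<le> m. - (2 / of_nat n * fps_nth C (m - n)))"
      unfolding fps_mult_nth atLeast0AtMost
      by (subst sum_odd_support) (auto simp: F_def intro!: sum.cong)
    then have "const (fps_nth (F * C) m) * q m =
        (\<Sum>n | odd n \<and> n \<le> m. - (const (fps_nth C (m - n)) * (const (2 / of_nat n) * q m)))"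
      by (simp only: const_sum const_simps sum_distrib_right mult_minus_left mult.assoc mult.left_commute)
    also have "\<dots> = (\<Sum>n | odd n \<and> n \<le> m. - dpsum n (const (fps_nth C (m - n)) * q (m - n)))"
      by (intro sum.cong) (auto simp: dq simp del: const_simps)
    finally show "fps_nth (annihilation_log (Abs_fps (\<lambda>m. const (fps_nth C m) * q m))) m =
          fps_nth (Abs_fps (\<lambda>m. const (fps_nth (F * C) m) * q m)) m"
      by (simp add: annihilation_log_def sum_negf)
  qed
  have "(annihilation_log ^^ j) (fps_const (fps_nth creation l)) = Abs_fps (\<lambda>m. const (fps_nth (F ^ j) m) * q m)" for j
  proof (induction j)
    case 0
    show ?case by (rule fps_ext) (simp add: q_def)
  next
    case (Suc j)
    then show ?case by (simp only: funpow.simps o_apply step power_Suc)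
  qed
  then have "fps_nth (annihilation (fps_nth creation l)) m =
      const (\<Sum>j\<le>m. 1 / of_nat (fact j) * fps_nth (F ^ j) m) * q m"
    by (simp only: annihilation_def fps_nth_Abs_fps const_sum sum_distrib_right const_simps mult.assoc)
  also have "(\<Sum>j\<le>m. 1 / of_nat (fact j) * fps_nth (F ^ j) m) = f_comp [m] 0"
    using trunc_exp_annihilation[of m] by (simp only: trunc_exp_def fps_nth_Abs_fps F_def)
  finally show ?thesis by (simp add: q_def)
qed

lemma vertexQ_creation:
  "vertexQ (int k) (fps_nth creation l) =
     (\<Sum>m\<le>l. const (f_comp [m] 0) * (fps_nth creation (k + m) * fps_nth creation (l - m)))"
proof -
  have "vertexQ (int k) (fps_nth creation l) =
      (\<Sum>m\<le>l. fps_nth creation (nat (int k + int m)) * fps_nth (annihilation (fps_nth creation l)) m)"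
    unfolding vertexQ_def
    by (subst Sum_any.expand_superset[of "{..l}"]) (auto simp: annihilation_creation)
  also have "\<dots> = (\<Sum>m\<le>l. const (f_comp [m] 0) * (fps_nth creation (k + m) * fps_nth creation (l - m)))"
    by (intro sum.cong) (auto simp: annihilation_creation nat_add_distrib algebra_simps)
  finally show ?thesis .
qed

lemma schurQ_two_parts:
  "schurQ [k, l] = (\<Sum>m\<le>l. const (f_comp [m] 0) * (fps_nth creation (k + m) * fps_nth creation (l - m)))"
proof -
  \<comment> \<open>The starting vector \<open>1\<close> is the creation coefficient of index
    \<open>0\<close>.\<close>
  have "vertexQ (int l) 1 = fps_nth creation l" using vertexQ_creation[of l 0] by simp
  then show ?thesis by (simp add: schurQ_def vertexQ_creation)
qed

section \<open>Pairing with products of two creation coefficients\<close>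

text \<open>In \<^typ>\<open>Qq fps fps\<close>, the outer variable \<open>x = fps_X\<close> counts the first index and the inner
  variable \<open>y = fps_const fps_X\<close> the second.\<close>

definition pairing :: "gamma \<Rightarrow> Qq fps fps" where
  "pairing f = Abs_fps (\<lambda>i. Abs_fps (\<lambda>j. gform f (fps_nth creation i * fps_nth creation j)))"

lemma pairing_nth: "fps_nth (fps_nth (pairing f) i) j = gform f (fps_nth creation i * fps_nth creation j)"
  by (simp add: pairing_def)

lemma fps_fps_ext: "(\<And>i j. fps_nth (fps_nth f i) j = fps_nth (fps_nth g i) j) \<Longrightarrow> f = g"
  by (intro fps_ext)

lemma pairing_sum: "pairing (\<Sum>i\<in>A. f i) = (\<Sum>i\<in>A. pairing (f i))"
  by (rule fps_fps_ext) (simp add: pairing_nth gform_sum_left fps_sum_nth)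

lemma pairing_const_mult: "pairing (const c * f) = fps_const (fps_const c) * pairing f"
  by (rule fps_fps_ext) (simp add: pairing_nth)

text \<open>By adjointness \<open>psum n\<close> acts as \<open>n / 2\<close> times the derivation
  on the second argument. The product rule lowers one index of the pair by \<open>n\<close> at a
  time, and \<open>2 / n\<close> cancels \<open>n / 2\<close>.\<close>

lemma pairing_psum_mult:
  assumes n: "odd n"
  shows "pairing (psum n * f) = (fps_X ^ n + fps_const fps_X ^ n) * pairing f"
proof (rule fps_fps_ext)
  fix i j
  let ?q = "fps_nth creation"
  have "dpsum n (?q i * ?q j) =
      const (2 / of_nat n) * ((if n \<le> i then ?q (i - n) * ?q j else 0) + (if n \<le> j then ?q i * ?q (j - n) else 0))"
    by (simp add: dpsum_mult dpsum_creation[OF n] algebra_simps del: const_simps)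
  then have "gform (psum n * f) (?q i * ?q j) = gform f
      ((if n \<le> i then ?q (i - n) * ?q j else 0) + (if n \<le> j then ?q i * ?q (j - n) else 0))"
    using n by (simp add: gform_psum_mult odd_pos)
  then show "fps_nth (fps_nth (pairing (psum n * f)) i) j =
        fps_nth (fps_nth ((fps_X ^ n + fps_const fps_X ^ n) * pairing f) i) j"
    by (simp add: pairing_nth gform_add_right distrib_right fps_X_power_mult_nth fps_const_power)
qed

text \<open>For \<open>i > 0\<close> the recurrence puts a positive multiple of the coefficient into
  the ideal of the power sums, which is orthogonal to \<open>1\<close> because the adjoint
  derivations kill \<open>1\<close>.\<close>

lemma gform_one_creation:
  "gform 1 (fps_nth creation i * g) = (if i = 0 then gform 1 g else 0)"
proof (cases "i = 0")
  case False
  have z: "gform 1 (psum n * g) = 0" if "odd n" for n g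
    using that by (simp add: gform_commute[of 1] gform_psum_mult)
  have "of_nat i * gform 1 (fps_nth creation i * g) = gform 1 (of_nat i * fps_nth creation i * g)"
    by (simp only: gform_const_mult_right mult.assoc flip: const_simps(6))
  also have "\<dots> = 0"
    unfolding creation_rec sum_distrib_right gform_sum_right mult.assoc gform_const_mult_right
    by (rule sum.neutral) (auto simp: z)
  finally show ?thesis using False by simp
qed simp

lemma pairing_one: "pairing 1 = 1"
  by (rule fps_fps_ext)
     (use gform_one_creation[of _ 1] in \<open>simp add: pairing_nth gform_one_creation\<close>)

section \<open>The functions g after the substitution\<close>

lemma qvar_plus_one: "qvar + 1 \<noteq> 0"
  by (simp add: qvar_def One_fract_def Zero_fract_def eq_fract one_pCons)

text \<open>The image of \<open>\<Sum>\<^sub>m g\<^sub>m z\<^sup>m\<close> under \<open>p\<^sub>n = y\<^sup>n\<close>; with \<open>p\<^sub>n = x\<^sup>n + y\<^sup>n\<close> it is the product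
  \<open>gser_at x * gser_at y\<close>.\<close>

definition gser_at :: "Qq fps fps \<Rightarrow> Qq fps fps fps" where
  "gser_at y = Abs_fps (\<lambda>m. fps_const (fps_const (f_comp [m] qvar)) * y ^ m)"

lemma fps_const_sum: "fps_const (\<Sum>i\<in>A. g i) = (\<Sum>i\<in>A. fps_const (g i :: 'a::comm_ring_1))"
  by (rule fps_ext) (simp add: fps_sum_nth)

lemma fps_XD_gser_at:
  "fps_XD (gser_at y) =
     Abs_fps (\<lambda>n. if odd n then fps_const (fps_const (2 * (qvar ^ n - 1))) * y ^ n else 0) * gser_at y"
    (is "_ = ?P * _")
proof (rule fps_ext)
  fix m
  let ?s = "\<lambda>c. fps_const (fps_const (c :: Qq))"
  have "fps_nth (fps_XD (gser_at y)) m = ?s (of_nat m * f_comp [m] qvar) * y ^ m"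
    by (simp add: gser_at_def mult.assoc fps_of_nat flip: fps_const_mult)
  also have "\<dots> = (\<Sum>n | odd n \<and> n \<le> m. ?s (2 * (qvar ^ n - 1) * f_comp [m - n] qvar) * y ^ m)"
    unfolding f_comp_rec[OF qvar_plus_one] by (simp only: fps_const_sum sum_distrib_right)
  also have "\<dots> = (\<Sum>n | odd n \<and> n \<le> m. fps_nth ?P n * fps_nth (gser_at y) (m - n))"
  proof (intro sum.cong)
    fix n assume "n \<in> {n. odd n \<and> n \<le> m}"
    then have "odd n" "y ^ m = y ^ n * y ^ (m - n)" by (simp_all flip: power_add)
    then show "?s (2 * (qvar ^ n - 1) * f_comp [m - n] qvar) * y ^ m = fps_nth ?P n * fps_nth (gser_at y) (m - n)"
      unfolding gser_at_def fps_nth_Abs_fps fps_const_mult[symmetric] by (simp only: not_False_eq_True if_True mult_ac)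
  qed simp
  also have "\<dots> = fps_nth (?P * gser_at y) m"
    unfolding fps_mult_nth atLeast0AtMost by (rule sum_odd_support[symmetric]) simp
  finally show "fps_nth (fps_XD (gser_at y)) m = fps_nth (?P * gser_at y) m" .
qed

text \<open>Logarithmic derivatives of a product add; the result is \<open>gser_rec\<close> with
  \<open>psum n\<close> replaced by \<open>y ^ n + z ^ n\<close>.\<close>

lemma gser_at_mult_rec:
  "of_nat m * fps_nth (gser_at y * gser_at z) m =
     (\<Sum>n | odd n \<and> n \<le> m. fps_const (fps_const (2 * (qvar ^ n - 1))) * (y ^ n + z ^ n) *
        fps_nth (gser_at y * gser_at z) (m - n))"
proof -
  define P where "P y = Abs_fps (\<lambda>n. if odd n then fps_const (fps_const (2 * (qvar ^ n - 1))) * y ^ n else 0)"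
    for y :: "Qq fps fps"
  have "fps_XD (gser_at y * gser_at z) = (P y + P z) * (gser_at y * gser_at z)"
  proof -
    have "fps_XD (gser_at y * gser_at z) = fps_XD (gser_at y) * gser_at z + gser_at y * fps_XD (gser_at z)"
      by (simp add: fps_XD_def algebra_simps)
    then show ?thesis by (simp add: fps_XD_gser_at P_def algebra_simps)
  qed
  then have "of_nat m * fps_nth (gser_at y * gser_at z) m = fps_nth ((P y + P z) * (gser_at y * gser_at z)) m"
    by (metis fps_XD_nth)
  also have "\<dots> = (\<Sum>n | odd n \<and> n \<le> m. fps_nth (P y + P z) n * fps_nth (gser_at y * gser_at z) (m - n))"
    unfolding fps_mult_nth[of "P y + P z"] atLeast0AtMost by (rule sum_odd_support) (simp add: P_def)
  also have "\<dots> = (\<Sum>n | odd n \<and> n \<le> m. fps_const (fps_const (2 * (qvar ^ n - 1))) * (y ^ n + z ^ n) *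
        fps_nth (gser_at y * gser_at z) (m - n))"
    by (intro sum.cong) (auto simp: P_def distrib_left)
  finally show ?thesis .
qed

definition gser_two :: "nat \<Rightarrow> Qq fps fps" where
  "gser_two m = fps_nth (gser_at fps_X * gser_at (fps_const fps_X)) m"

text \<open>Both sides satisfy the same recurrence in \<open>m\<close>, since \<open>pairing\<close>
  turns each \<open>psum n\<close> into the sum of the \<open>n\<close>-th powers of the two
  variables.\<close>

lemma pairing_gser_mult: "pairing (fps_nth gser m * f) = gser_two m * pairing f"
proof (induction m rule: less_induct)
  case (less m)
  show ?case
  proof (cases "m = 0")
    case True
    then show ?thesis by (simp add: gser_two_def gser_at_def gser_def gexp_nth_0)
  next
    case False
    have "of_nat m * pairing (fps_nth gser m * f) = pairing (of_nat m * fps_nth gser m * f)"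
      by (simp only: pairing_const_mult mult.assoc fps_of_nat[symmetric] const_simps(6)[symmetric])
    also have "\<dots> = (\<Sum>n | odd n \<and> n \<le> m. fps_const (fps_const (2 * (qvar ^ n - 1))) *
        ((fps_X ^ n + fps_const fps_X ^ n) * pairing (fps_nth gser (m - n) * f)))"
      unfolding gser_rec sum_distrib_right pairing_sum mult.assoc pairing_const_mult
      by (intro sum.cong) (auto simp: pairing_psum_mult)
    also have "\<dots> = (\<Sum>n | odd n \<and> n \<le> m. fps_const (fps_const (2 * (qvar ^ n - 1))) *
        (fps_X ^ n + fps_const fps_X ^ n) * gser_two (m - n)) * pairing f"
      unfolding sum_distrib_right using False
      by (intro sum.cong) (auto simp: less odd_pos mult.assoc)
    also have "\<dots> = of_nat m * (gser_two m * pairing f)"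
      by (simp only: gser_at_mult_rec gser_two_def mult.assoc[symmetric])
    finally have "of_nat m * pairing (fps_nth gser m * f) = of_nat m * (gser_two m * pairing f)" .
    with False show ?thesis by simp
  qed
qed

lemma pairing_g_part: "pairing (g_part \<mu>) = (\<Prod>m\<leftarrow>\<mu>. gser_two m)"
  by (induction \<mu>) (simp_all add: g_part_def pairing_one pairing_gser_mult)

section \<open>Coefficient extraction and the polynomials \<open>c_i\<close>\<close>

lemma gser_two_mult_nth:
  "fps_nth (fps_nth (gser_two m * Y) i) j =
     (\<Sum>\<tau>\<le>m. if \<tau> \<le> i \<and> m - \<tau> \<le> j
        then f_comp [\<tau>] qvar * f_comp [m - \<tau>] qvar * fps_nth (fps_nth Y (i - \<tau>)) (j - (m - \<tau>)) else 0)"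
proof -
  \<comment> \<open>The summation index is the exponent of \<open>x\<close>; the remaining
    \<open>m - \<tau>\<close> is that of \<open>y\<close>.\<close>
  have "gser_two m * Y = (\<Sum>\<tau>\<le>m. fps_const (fps_const (f_comp [\<tau>] qvar * f_comp [m - \<tau>] qvar)) *
      (fps_X ^ \<tau> * (fps_const (fps_X ^ (m - \<tau>)) * Y)))"
    unfolding gser_two_def gser_at_def fps_mult_nth atLeast0AtMost sum_distrib_right fps_nth_Abs_fps
      fps_const_power fps_const_mult[symmetric]
    by (simp only: mult_ac)
  then show ?thesis
    by (auto simp: fps_sum_nth fps_X_power_mult_nth intro!: sum.cong)
qed

lemma c_poly_Nil: "c_poly i [] t = (if i = 0 then 1 else 0)"
proof -
  have "subcomps [] i = (if i = 0 then {[]} else {})" by (auto simp: subcomps_def)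
  then show ?thesis by (simp add: c_poly_def f_comp_def num_parts_def tnum_comp_def)
qed

lemma c_poly_Cons:
  "c_poly i (m # \<mu>) t =
     (\<Sum>\<tau>\<le>m. if \<tau> \<le> i then f_comp [\<tau>] t * f_comp [m - \<tau>] t * c_poly (i - \<tau>) \<mu> t else 0)"
proof -
  have split: "f_comp (a # \<sigma>) t * f_comp ((m - a) # map2 (-) \<mu> \<sigma>) t =
      f_comp [a] t * f_comp [m - a] t * (f_comp \<sigma> t * f_comp (map2 (-) \<mu> \<sigma>) t)" for a \<sigma>
    by (simp only: f_comp_Cons[of a \<sigma>] f_comp_Cons[of "m - a" "map2 (-) \<mu> \<sigma>"] mult_ac)
  have "c_poly i (m # \<mu>) t = (\<Sum>(\<tau>, \<sigma>)\<in>(SIGMA \<tau>:{\<tau>\<in>{..m}. \<tau> \<le> i}. subcomps \<mu> (i - \<tau>)).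
          f_comp [\<tau>] t * f_comp [m - \<tau>] t * (f_comp \<sigma> t * f_comp (map2 (-) \<mu> \<sigma>) t))"
    unfolding c_poly_def
    by (rule sum.reindex_bij_witness[where i = "\<lambda>(\<tau>, \<sigma>). \<tau> # \<sigma>" and j = "\<lambda>\<sigma>. (hd \<sigma>, tl \<sigma>)"])
       (auto simp: subcomps_def list_all2_Cons2 split)
  also have "\<dots> = (\<Sum>\<tau>\<in>{\<tau>\<in>{..m}. \<tau> \<le> i}. f_comp [\<tau>] t * f_comp [m - \<tau>] t * c_poly (i - \<tau>) \<mu> t)"
    by (subst sum.Sigma[symmetric]) (auto simp: finite_subcomps c_poly_def sum_distrib_left)
  finally show ?thesis by (simp only: sum.inter_filter finite_atMost)
qed

lemma c_poly_eq_0: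
  assumes "sum_list \<mu> < i"
  shows "c_poly i \<mu> t = 0"
proof -
  have "sum_list \<tau> \<le> sum_list \<mu>" if "list_all2 (\<le>) \<tau> \<mu>" for \<tau>
    using that by induction auto
  with assms have "subcomps \<mu> i = {}" by (force simp: subcomps_def)
  then show ?thesis by (simp add: c_poly_def)
qed

text \<open>The coefficients obey the same recursion over the parts as \<open>c_poly\<close>, and
  each factor is homogeneous in \<open>x\<close> and \<open>y\<close> of degree its part.\<close>

lemma prod_gser_two_nth:
  "fps_nth (fps_nth (\<Prod>m\<leftarrow>\<mu>. gser_two m) i) j = (if i + j = sum_list \<mu> then c_poly i \<mu> qvar else 0)"
proof (induction \<mu> arbitrary: i j)
  case Nil
  then show ?case by (simp add: c_poly_Nil)
next
  case (Cons m \<mu>)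
  \<comment> \<open>If the total degree is right but \<open>m - \<tau> > j\<close>, then
    \<open>i - \<tau>\<close> exceeds \<open>sum_list \<mu>\<close> and \<open>c_poly\<close>
    vanishes, so the guard on \<open>j\<close> can go.\<close>
  have "(if \<tau> \<le> i \<and> m - \<tau> \<le> j then f_comp [\<tau>] qvar * f_comp [m - \<tau>] qvar *
          (if i - \<tau> + (j - (m - \<tau>)) = sum_list \<mu> then c_poly (i - \<tau>) \<mu> qvar else 0) else 0) =
        (if i + j = m + sum_list \<mu> then if \<tau> \<le> i then f_comp [\<tau>] qvar * f_comp [m - \<tau>] qvar *
          c_poly (i - \<tau>) \<mu> qvar else 0 else 0)" if "\<tau> \<le> m" for \<tau>
    using that c_poly_eq_0[of \<mu> "i - \<tau>" qvar] by auto
  note eq = this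
  show ?case
    unfolding list.map prod_list.Cons gser_two_mult_nth Cons.IH sum_list.Cons c_poly_Cons
    by (subst sum.cong[OF refl eq]) simp_all
qed

lemma gform_g_part:
  "gform (g_part \<mu>) (fps_nth creation i * fps_nth creation j) =
     (if i + j = sum_list \<mu> then c_poly i \<mu> qvar else 0)"
  unfolding pairing_nth[symmetric] pairing_g_part by (rule prod_gser_two_nth)

theorem theorem2p9:
  fixes n k :: nat and \<mu> :: "nat list"
  assumes "k > n - k" and "n - k > 0"
    and "\<mu> \<in> odd_partitions n"
  shows "zeta [k, n - k] \<mu> =
    1 / (2 * (qvar - 1) ^ num_parts \<mu>) *
      ((\<Sum>i = k + 1..n. (-1) ^ (i - k) * c_poly i \<mu> qvar) +
       (\<Sum>i = k..n. (-1) ^ (i - k) * c_poly i \<mu> qvar))"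
proof -
  define l where "l = n - k"
  define h where "h m = (-1) ^ m * c_poly (k + m) \<mu> qvar" for m
  have l: "n = k + l" using assms(2) by (simp add: l_def)
  have \<mu>: "sum_list \<mu> = k + l" using assms(3) by (simp add: odd_partitions_def partitions_def l)
  have f: "f_comp [m] 0 = (if m = 0 then 1 else 2 * (-1) ^ m :: Qq)" for m
    by (auto simp: f_comp_pos zero_power)
  have "gform (g_part \<mu>) (schurQ [k, l]) = (\<Sum>m\<le>l. f_comp [m] 0 * c_poly (k + m) \<mu> qvar)"
    by (auto simp: schurQ_two_parts gform_sum_right gform_g_part \<mu> intro!: sum.cong)
  also have "\<dots> = h 0 + (\<Sum>m=1..l. 2 * h m)"
    by (simp add: f h_def sum.atLeast_Suc_atMost[of 0] mult.assoc flip: atLeast0AtMost)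
  \<comment> \<open>Every term but the first is doubled, which accounts for the two sums with
    different starting points.\<close>
  also have "\<dots> = (\<Sum>m=1..l. h m) + (\<Sum>m=0..l. h m)"
    by (simp add: sum.atLeast_Suc_atMost[of 0] flip: sum_distrib_left)
  also have "(\<Sum>m=1..l. h m) = (\<Sum>i = k + 1..n. (-1) ^ (i - k) * c_poly i \<mu> qvar)"
    by (rule sum.reindex_bij_witness[where i = "\<lambda>i. i - k" and j = "\<lambda>m. k + m"]) (auto simp: h_def l)
  also have "(\<Sum>m=0..l. h m) = (\<Sum>i = k..n. (-1) ^ (i - k) * c_poly i \<mu> qvar)"
    by (rule sum.reindex_bij_witness[where i = "\<lambda>i. i - k" and j = "\<lambda>m. k + m"]) (auto simp: h_def l)
  finally have "gform (g_part \<mu>) (schurQ [k, n - k]) =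
    (\<Sum>i = k + 1..n. (-1) ^ (i - k) * c_poly i \<mu> qvar) + (\<Sum>i = k..n. (-1) ^ (i - k) * c_poly i \<mu> qvar)"
    by (simp only: l_def)
  \<comment> \<open>Both parts are positive, so the power of two in \<open>zeta\<close> is
    \<open>2 ^ (2 div 2) = 2\<close>, the factor \<open>1 / 2\<close> of the formula.\<close>
  moreover have "num_parts [k, n - k] = 2" using assms by (simp add: num_parts_def)
  ultimately show ?thesis by (simp add: zeta_def)
qed

end
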